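(* Let $\varphi,\psi\colon K\to L$ be simplicial maps. If $\varphi\sim\psi$, then $\mathrm{SimpD}(\varphi,\psi)=0$.
   Context: $K,L$ are (ordered) simplicial complexes: abstract simplicial complexes with a partial order on the vertices restricting to a total order on each simplex. A simplicial map is a map of vertices sending simplices to simplices. Contiguity: simplicial maps $\varphi,\psi\colon K\to L$ are contiguous if for every simplex $\sigma$ of $K$, $\varphi(\sigma)\cup\psi(\sigma)$ is a simplex of $L$. For $c\in\mathbb{Z}_{\ge0}$, they are $c$-contiguous ($\varphi\sim_c\psi$) if there are simplicial maps $H_0,\dots,H_c\colon K\to L$ with $H_0=\varphi$, $H_c=\psi$ and each pair $(H_{i-1},H_i)$ contiguous, $1\le i\le c$. We write $\varphi\sim\psi$ (same contiguity class) if $\varphi\sim_c\psi$ for some $c\ge 0$. Subdivisions: $\mathrm{Sd}^b(K)$ is the $b$-th iterated barycentric subdivision ($\mathrm{Sd}^0(K)=K$). For each $b\ge 0$ a simplicial approximation $\iota\colon\mathrm{Sd}^{b+1}(K)\to\mathrm{Sd}^b(K)$ of the identity of the realization $\|K\|$ is fixed (i.e. a simplicial map sending each vertex of $\mathrm{Sd}^{b+1}(K)$, regarded as a simplex $\sigma$ of $\mathrm{Sd}^b(K)$, to a vertex of $\sigma$); composites of these are also denoted $\iota\colon \mathrm{Sd}^b(K)\to K$. Simplicial distance: for simplicial maps $\varphi,\psi\colon K\to L$ and $b,c\in\mathbb{Z}_{\ge0}$, $\mathrm{SimpD}^b_c(\varphi,\psi)$ is the least integer $k\ge0$ such that there are subcomplexes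 $J_0,\dots,J_k$ covering $\mathrm{Sd}^b(K)$ for which the composites $J_i\hookrightarrow\mathrm{Sd}^b(K)\xrightarrow{\iota}K\xrightarrow{\varphi}L$ and $J_i\hookrightarrow\mathrm{Sd}^b(K)\xrightarrow{\iota}K\xrightarrow{\psi}L$ are $c$-contiguous for each $i$; it is $\infty$ if no such $k$ exists. It is non-increasing in $c$; $\mathrm{SimpD}^b(\varphi,\psi)$ denotes its stable value as $c\to\infty$. The sequence $\mathrm{SimpD}^b(\varphi,\psi)$ is non-increasing in $b$; $\mathrm{SimpD}(\varphi,\psi)$ denotes its stable value as $b\to\infty$. *)

theory Defs
  imports "HOL-Library.FSet" "HOL-Library.Extended_Nat"
begin

text \<open>
  Simplices are finite sets of vertices. No separate vertex set is stored: the vertices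
  are the elements of simplices, and \<^term>\<open>le\<close> is a relation on them.
  The empty complex is allowed, and complexes need not be finite.
\<close>

record 'a ocomplex =
  simplices :: "'a fset set"
  le :: "('a \<times> 'a) set"

definition vertices :: "'a ocomplex \<Rightarrow> 'a set" where
  "vertices K = (\<Union>\<sigma>\<in>simplices K. fset \<sigma>)"

definition ordered_complex :: "'a ocomplex \<Rightarrow> bool" where
  "ordered_complex K \<longleftrightarrow>
     (\<forall>\<sigma>\<in>simplices K. \<sigma> \<noteq> {||}) \<and>
     (\<forall>\<sigma>\<in>simplices K. \<forall>\<tau>. \<tau> |\<subseteq>| \<sigma> \<longrightarrow> \<tau> \<noteq> {||} \<longrightarrow> \<tau> \<in> simplices K) \<and>
     partial_order_on (vertices K) (le K) \<and>
     (\<forall>\<sigma>\<in>simplices K. total_on (fset \<sigma>) (le K))"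

definition subcomplex :: "'a ocomplex \<Rightarrow> 'a ocomplex \<Rightarrow> bool" where
  "subcomplex J K \<longleftrightarrow>
     ordered_complex J \<and> simplices J \<subseteq> simplices K \<and> le J = Restr (le K) (vertices J)"

text \<open>
  A map of complexes is represented by a total function on the vertex types; only its values
  on the vertices of the source matter. Accordingly the restriction of a map to a subcomplex
  is given by the same function, and two maps count as equal if they agree on all vertices.
  Simplicial maps need not be monotone for the vertex orders.
\<close>

definition simplicial_map :: "'a ocomplex \<Rightarrow> 'b ocomplex \<Rightarrow> ('a \<Rightarrow> 'b) \<Rightarrow> bool" where
  "simplicial_map K L f \<longleftrightarrow> (\<forall>\<sigma>\<in>simplices K. f |`| \<sigma> \<in> simplices L)"

definition contiguous :: "'a ocomplex \<Rightarrow> 'b ocomplex \<Rightarrow> ('a \<Rightarrow> 'b) \<Rightarrow> ('a \<Rightarrow> 'b) \<Rightarrow> bool" where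
  "contiguous K L \<phi> \<psi> \<longleftrightarrow>
     simplicial_map K L \<phi> \<and> simplicial_map K L \<psi> \<and>
     (\<forall>\<sigma>\<in>simplices K. \<phi> |`| \<sigma> |\<union>| \<psi> |`| \<sigma> \<in> simplices L)"

definition c_contiguous ::
    "nat \<Rightarrow> 'a ocomplex \<Rightarrow> 'b ocomplex \<Rightarrow> ('a \<Rightarrow> 'b) \<Rightarrow> ('a \<Rightarrow> 'b) \<Rightarrow> bool" where
  "c_contiguous c K L \<phi> \<psi> \<longleftrightarrow>
     (\<exists>H :: nat \<Rightarrow> 'a \<Rightarrow> 'b.
        (\<forall>i\<le>c. simplicial_map K L (H i)) \<and>
        (\<forall>v\<in>vertices K. H 0 v = \<phi> v) \<and>
        (\<forall>v\<in>vertices K. H c v = \<psi> v) \<and>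
        (\<forall>i\<in>{1..c}. contiguous K L (H (i - 1)) (H i)))"

definition same_contiguity_class ::
    "'a ocomplex \<Rightarrow> 'b ocomplex \<Rightarrow> ('a \<Rightarrow> 'b) \<Rightarrow> ('a \<Rightarrow> 'b) \<Rightarrow> bool" where
  "same_contiguity_class K L \<phi> \<psi> \<longleftrightarrow> (\<exists>c. c_contiguous c K L \<phi> \<psi>)"

text \<open>
  The vertices of the barycentric subdivision are the simplices of \<^term>\<open>K\<close>, ordered by
  inclusion; its simplices are the finite nonempty chains.
\<close>

definition barycentric :: "'a ocomplex \<Rightarrow> 'a fset ocomplex" where
  "barycentric K =
     \<lparr> simplices = {C. C \<noteq> {||} \<and> fset C \<subseteq> simplices K \<and>
                       (\<forall>\<sigma>\<in>fset C. \<forall>\<tau>\<in>fset C. \<sigma> |\<subseteq>| \<tau> \<or> \<tau> |\<subseteq>| \<sigma>)},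
       le = {(\<sigma>, \<tau>). \<sigma> \<in> simplices K \<and> \<tau> \<in> simplices K \<and> \<sigma> |\<subseteq>| \<tau>} \<rparr>"

text \<open>
  Subdividing changes the vertex type from \<^typ>\<open>'a\<close> to \<^typ>\<open>'a fset\<close>. In order to iterate,
  all the complexes \<open>Sd b K\<close> are placed in one type, whose constructors serve only as (injective)
  labels: \<open>Base v\<close> stands for the vertex \<open>v\<close> of \<open>K\<close>, and \<open>Bary \<sigma>\<close> for the simplex \<open>\<sigma>\<close>
  regarded as a vertex of the next subdivision. In particular \<open>Sd 0 K\<close> is the copy of \<open>K\<close>
  with every \<open>v\<close> renamed to \<open>Base v\<close>.
\<close>

datatype 'a sd_vertex = Base 'a | Bary "'a sd_vertex fset"

definition relabel :: "('a \<Rightarrow> 'b) \<Rightarrow> 'a ocomplex \<Rightarrow> 'b ocomplex" where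
  "relabel f K = \<lparr> simplices = (\<lambda>\<sigma>. f |`| \<sigma>) ` simplices K, le = map_prod f f ` le K \<rparr>"

primrec Sd :: "nat \<Rightarrow> 'a ocomplex \<Rightarrow> 'a sd_vertex ocomplex" where
  "Sd 0 K = relabel Base K"
| "Sd (Suc b) K = relabel Bary (barycentric (Sd b K))"

text \<open>
  \<open>\<iota> b\<close> is the chosen approximation of the identity from \<open>Sd (b + 1) K\<close> to \<open>Sd b K\<close>.
\<close>

definition identity_approximations ::
    "'a ocomplex \<Rightarrow> (nat \<Rightarrow> 'a sd_vertex \<Rightarrow> 'a sd_vertex) \<Rightarrow> bool" where
  "identity_approximations K \<iota> \<longleftrightarrow>
     (\<forall>b. simplicial_map (Sd (Suc b) K) (Sd b K) (\<iota> b) \<and>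
          (\<forall>\<sigma>\<in>simplices (Sd b K). \<iota> b (Bary \<sigma>) |\<in>| \<sigma>))"

text \<open>
  The composite from \<open>Sd b K\<close> to \<open>K\<close>, including the removal of the label \<^const>\<open>Base\<close>
  at the end; the \<^const>\<open>Bary\<close> case of \<open>unbase\<close> is not met on vertices of \<open>Sd 0 K\<close>.
\<close>

definition unbase :: "'a sd_vertex \<Rightarrow> 'a" where
  "unbase x = (case x of Base v \<Rightarrow> v | Bary _ \<Rightarrow> undefined)"

primrec iota_to_base :: "(nat \<Rightarrow> 'a sd_vertex \<Rightarrow> 'a sd_vertex) \<Rightarrow> nat \<Rightarrow> 'a sd_vertex \<Rightarrow> 'a" where
  "iota_to_base \<iota> 0 = unbase"
| "iota_to_base \<iota> (Suc b) = iota_to_base \<iota> b \<circ> \<iota> b"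

text \<open>In \<^typ>\<open>enat\<close>, the infimum of a nonempty set is its least element, and \<open>Inf {} = \<infinity>\<close>.\<close>

definition SimpD_bc ::
    "(nat \<Rightarrow> 'a sd_vertex \<Rightarrow> 'a sd_vertex) \<Rightarrow> 'a ocomplex \<Rightarrow> 'b ocomplex \<Rightarrow> nat \<Rightarrow> nat \<Rightarrow>
     ('a \<Rightarrow> 'b) \<Rightarrow> ('a \<Rightarrow> 'b) \<Rightarrow> enat" where
  "SimpD_bc \<iota> K L b c \<phi> \<psi> =
     Inf {enat k | k. \<exists>J :: nat \<Rightarrow> 'a sd_vertex ocomplex.
       (\<forall>i\<le>k. subcomplex (J i) (Sd b K)) \<and>
       (\<Union>i\<le>k. simplices (J i)) = simplices (Sd b K) \<and>
       (\<forall>i\<le>k. c_contiguous c (J i) L (\<phi> \<circ> iota_to_base \<iota> b) (\<psi> \<circ> iota_to_base \<iota> b))}"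

text \<open>
  The stable value of an eventually constant sequence. Non-increasing sequences in
  \<^typ>\<open>enat\<close> are eventually constant.
\<close>

definition stable_value :: "(nat \<Rightarrow> 'a) \<Rightarrow> 'a" where
  "stable_value f = (THE v. \<forall>\<^sub>F n in sequentially. f n = v)"

definition SimpD_b ::
    "(nat \<Rightarrow> 'a sd_vertex \<Rightarrow> 'a sd_vertex) \<Rightarrow> 'a ocomplex \<Rightarrow> 'b ocomplex \<Rightarrow> nat \<Rightarrow>
     ('a \<Rightarrow> 'b) \<Rightarrow> ('a \<Rightarrow> 'b) \<Rightarrow> enat" where
  "SimpD_b \<iota> K L b \<phi> \<psi> = stable_value (\<lambda>c. SimpD_bc \<iota> K L b c \<phi> \<psi>)"

definition SimpD ::
    "(nat \<Rightarrow> 'a sd_vertex \<Rightarrow> 'a sd_vertex) \<Rightarrow> 'a ocomplex \<Rightarrow> 'b ocomplex \<Rightarrow>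
     ('a \<Rightarrow> 'b) \<Rightarrow> ('a \<Rightarrow> 'b) \<Rightarrow> enat" where
  "SimpD \<iota> K L \<phi> \<psi> = stable_value (\<lambda>b. SimpD_b \<iota> K L b \<phi> \<psi>)"

end

theory Submission
  imports Defs
begin

text \<open>
  Precomposing a contiguity chain of length \<open>c\<close> with the simplicial map \<open>Sd b K \<rightarrow> K\<close> gives such
  a chain on all of \<open>Sd b K\<close>, so a single subcomplex, \<open>Sd b K\<close> itself, suffices for every \<open>b\<close>
  and every larger \<open>c\<close>.
\<close>

lemma vertices_relabel: "vertices (relabel f K) = f ` vertices K"
  by (auto simp: vertices_def relabel_def)

text \<open>Transport along the labels: this handles \<open>Base\<close> and \<open>Bary\<close>
  alike in the construction of \<open>Sd\<close>.\<close>

lemma ordered_complex_relabel: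
  assumes "inj f" "ordered_complex K"
  shows "ordered_complex (relabel f K)"
proof -
  have K: "\<And>\<sigma>. \<sigma> \<in> simplices K \<Longrightarrow> \<sigma> \<noteq> {||}"
    "\<And>\<sigma> \<tau>. \<sigma> \<in> simplices K \<Longrightarrow> \<tau> |\<subseteq>| \<sigma> \<Longrightarrow> \<tau> \<noteq> {||} \<Longrightarrow> \<tau> \<in> simplices K"
    "partial_order_on (vertices K) (le K)"
    "\<And>\<sigma>. \<sigma> \<in> simplices K \<Longrightarrow> total_on (fset \<sigma>) (le K)"
    using assms(2) unfolding ordered_complex_def by blast+
  have "\<tau> \<in> (|`|) f ` simplices K"
    if \<tau>: "\<sigma> \<in> simplices K" "\<tau> |\<subseteq>| f |`| \<sigma>" "\<tau> \<noteq> {||}" for \<sigma> \<tau>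
  proof -
    \<comment> \<open>A face of an image simplex is itself the image of a face, so closure under
      faces carries over from \<open>K\<close>.\<close>
    obtain \<rho> where "\<rho> |\<subseteq>| \<sigma>" "\<tau> = f |`| \<rho>"
      using \<tau>(2) by (auto simp: subset_fimage_iff)
    then show ?thesis using K(2) \<tau> by auto
  qed
  moreover have "partial_order_on (vertices (relabel f K)) (le (relabel f K))"
    unfolding partial_order_on_def preorder_on_def vertices_relabel
  proof (intro conjI)
    have po: "le K \<subseteq> vertices K \<times> vertices K" "refl_on (vertices K) (le K)" "trans (le K)" "antisym (le K)"
      using K(3) by (auto simp: partial_order_on_def preorder_on_def)
    show "le (relabel f K) \<subseteq> f ` vertices K \<times> f ` vertices K"
      using po(1) by (auto simp: relabel_def)
    show "refl_on (f ` vertices K) (le (relabel f K))"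
      using po(2) by (fastforce simp: relabel_def refl_on_def)
    \<comment> \<open>Injectivity enters here: two relabelled pairs sharing a middle vertex come
      from pairs of \<open>le K\<close> that share one.\<close>
    show "trans (le (relabel f K))"
      using po(3) assms(1) by (auto simp: relabel_def inj_eq intro!: transI dest: transD)
    show "antisym (le (relabel f K))"
      using po(4) assms(1) by (auto simp: relabel_def inj_eq intro!: antisymI dest: antisymD)
  qed
  moreover have "total_on (fset (f |`| \<sigma>)) (map_prod f f ` le K)" if "\<sigma> \<in> simplices K" for \<sigma>
    using K(4)[OF that] by (fastforce simp: total_on_def)
  ultimately show ?thesis
    unfolding ordered_complex_def using K(1) by (auto simp: relabel_def)
qed

text \<open>Each simplex forms a one-element chain by itself, hence occurs as a vertex.\<close>

lemma vertices_barycentric: "vertices (barycentric K) = simplices K"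
proof
  show "simplices K \<subseteq> vertices (barycentric K)"
  proof
    fix \<sigma> assume "\<sigma> \<in> simplices K"
    then have "{|\<sigma>|} \<in> simplices (barycentric K)" by (simp add: barycentric_def)
    then show "\<sigma> \<in> vertices (barycentric K)" unfolding vertices_def by fastforce
  qed
qed (auto simp: vertices_def barycentric_def)

lemma ordered_complex_barycentric: "ordered_complex (barycentric K)"
  unfolding ordered_complex_def vertices_barycentric
proof (intro conjI ballI allI impI)
  show "partial_order_on (simplices K) (le (barycentric K))"
    unfolding partial_order_on_def preorder_on_def
  proof (intro conjI)
    show "trans (le (barycentric K))"
      by (rule transI) (simp add: barycentric_def, blast intro: order_trans)
    show "antisym (le (barycentric K))"
      by (rule antisymI) (simp add: barycentric_def)
  qed (simp_all add: barycentric_def refl_on_def subset_iff)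
next
  fix C \<tau> assume "C \<in> simplices (barycentric K)" "\<tau> |\<subseteq>| C" "\<tau> \<noteq> {||}"
  then show "\<tau> \<in> simplices (barycentric K)"
    unfolding less_eq_fset.rep_eq barycentric_def ocomplex.simps mem_Collect_eq
    by (meson subset_iff)
next
  fix C assume "C \<in> simplices (barycentric K)"
  then show "total_on (fset C) (le (barycentric K))"
    unfolding total_on_def barycentric_def ocomplex.simps mem_Collect_eq by blast
qed (simp add: barycentric_def)

text \<open>A case split replaces induction: every positive stage is a relabelled poset of simplices
  under inclusion, with its finite nonempty chains.\<close>

lemma ordered_complex_Sd: "ordered_complex K \<Longrightarrow> ordered_complex (Sd b K)"
  by (cases b) (simp_all add: ordered_complex_relabel ordered_complex_barycentric inj_def)

lemma subcomplex_refl: "ordered_complex K \<Longrightarrow> subcomplex K K"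
  unfolding subcomplex_def
proof (intro conjI)
  assume "ordered_complex K"
  then have "le K \<subseteq> vertices K \<times> vertices K"
    unfolding ordered_complex_def partial_order_on_def preorder_on_def by (elim conjE)
  then show "le K = Restr (le K) (vertices K)" by (simp add: inf_absorb1)
qed simp_all

text \<open>Images under a composite are iterated images, so the condition on simplices is passed
  along.\<close>

lemma simplicial_map_comp:
  "simplicial_map K L f \<Longrightarrow> simplicial_map L M g \<Longrightarrow> simplicial_map K M (g \<circ> f)"
  by (auto simp: simplicial_map_def simp flip: fset.map_comp)

lemma simplicial_map_vertices:
  "simplicial_map K L f \<Longrightarrow> v \<in> vertices K \<Longrightarrow> f v \<in> vertices L"
  unfolding simplicial_map_def vertices_def UN_iff
  by (elim bexE, drule bspec, assumption) (rule bexI, rule fimageI)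

lemma contiguous_refl: "simplicial_map K L f \<Longrightarrow> contiguous K L f f"
  by (simp add: contiguous_def simplicial_map_def)

lemma contiguous_comp:
  assumes "simplicial_map J K h" "contiguous K L f g"
  shows "contiguous J L (f \<circ> h) (g \<circ> h)"
  using assms unfolding contiguous_def
  by (auto intro: simplicial_map_comp) (auto simp: simplicial_map_def simp flip: fset.map_comp)

text \<open>Each map of the chain is precomposed with \<open>h\<close>. The endpoints still match
  because \<open>h\<close> sends vertices of \<open>J\<close> to vertices of \<open>K\<close>, where
  the original chain agrees with \<open>f\<close> and \<open>g\<close>.\<close>

lemma c_contiguous_comp:
  assumes "simplicial_map J K h" "c_contiguous c K L f g"
  shows "c_contiguous c J L (f \<circ> h) (g \<circ> h)"
proof -
  obtain H where "\<forall>i\<le>c. simplicial_map K L (H i)"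
    "\<forall>v\<in>vertices K. H 0 v = f v" "\<forall>v\<in>vertices K. H c v = g v"
    "\<forall>i\<in>{1..c}. contiguous K L (H (i - 1)) (H i)"
    using assms(2) unfolding c_contiguous_def by blast
  then show ?thesis
    unfolding c_contiguous_def using assms(1)
    by (intro exI[of _ "\<lambda>i. H i \<circ> h"])
      (auto simp: simplicial_map_vertices intro: simplicial_map_comp contiguous_comp)
qed

text \<open>A chain is lengthened by repeating its last map, since a simplicial map is contiguous to
  itself.\<close>

lemma c_contiguous_mono:
  assumes "c_contiguous c K L f g" "c \<le> d"
  shows "c_contiguous d K L f g"
proof -
  obtain H where H: "\<forall>i\<le>c. simplicial_map K L (H i)"
    "\<forall>v\<in>vertices K. H 0 v = f v" "\<forall>v\<in>vertices K. H c v = g v"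
    "\<forall>i\<in>{1..c}. contiguous K L (H (i - 1)) (H i)"
    using assms(1) unfolding c_contiguous_def by blast
  have "contiguous K L (H (min (i - 1) c)) (H (min i c))" if "i \<in> {1..d}" for i
  proof (cases "i \<le> c")
    case True
    then have "min (i - 1) c = i - 1" "min i c = i" by simp_all
    then show ?thesis using H(4) True that by simp
  next
    case False
    \<comment> \<open>Already at \<open>i = c + 1\<close> the predecessor index is \<open>c\<close>,
      so both maps are \<open>H c\<close>.\<close>
    then have "min (i - 1) c = c" "min i c = c" by simp_all
    then show ?thesis using H(1) by (simp add: contiguous_refl)
  qed
  then show ?thesis
    unfolding c_contiguous_def using H assms(2)
    by (intro exI[of _ "\<lambda>i. H (min i c)"]) (auto simp: min_absorb2)
qed

text \<open>At stage 0 the composite merely strips the label \<open>Base\<close>; each further stage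
  adds one simplicial approximation.\<close>

lemma simplicial_map_iota_to_base:
  assumes "identity_approximations K \<iota>"
  shows "simplicial_map (Sd b K) K (iota_to_base \<iota> b)"
proof (induction b)
  case 0
  have "unbase |`| (Base |`| \<sigma>) = \<sigma>" for \<sigma> :: "'a fset"
    by (simp add: fset.map_comp o_def unbase_def)
  then show ?case
    by (auto simp: simplicial_map_def relabel_def)
next
  case (Suc b)
  then show ?case
    using assms simplicial_map_comp unfolding identity_approximations_def iota_to_base.simps
    by blast
qed

text \<open>The value \<open>k\<close> counts \<open>k + 1\<close> subcomplexes, so the one-member
  cover by \<open>Sd b K\<close> itself witnesses 0.\<close>

lemma SimpD_bc_eq_0:
  assumes "ordered_complex K" "c_contiguous c (Sd b K) L (\<phi> \<circ> iota_to_base \<iota> b) (\<psi> \<circ> iota_to_base \<iota> b)"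
  shows "SimpD_bc \<iota> K L b c \<phi> \<psi> = 0"
proof -
  have "SimpD_bc \<iota> K L b c \<phi> \<psi> \<le> enat 0"
    unfolding SimpD_bc_def using assms
    by (intro Inf_lower CollectI exI[of _ 0] exI[of _ "\<lambda>_. Sd b K"] conjI)
      (auto intro: subcomplex_refl ordered_complex_Sd)
  then show ?thesis by (simp flip: zero_enat_def)
qed

text \<open>Two eventual values agree at some common index, so the description in
  \<open>stable_value\<close> is unique.\<close>

lemma stable_value_eqI:
  assumes "\<forall>\<^sub>F n in sequentially. f n = v"
  shows "stable_value f = v"
  unfolding stable_value_def
proof (rule the_equality)
  fix w assume "\<forall>\<^sub>F n in sequentially. f n = w"
  with assms have "\<forall>\<^sub>F n::nat in sequentially. w = v"
    by eventually_elim simp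
  then show "w = v" by simp
qed (rule assms)

theorem theorem3p5:
  fixes K :: "'a ocomplex" and L :: "'b ocomplex"
    and \<phi> \<psi> :: "'a \<Rightarrow> 'b"
    and \<iota> :: "nat \<Rightarrow> 'a sd_vertex \<Rightarrow> 'a sd_vertex"
  assumes "ordered_complex K" and "ordered_complex L"
    and "identity_approximations K \<iota>"
    and "simplicial_map K L \<phi>" and "simplicial_map K L \<psi>"
    and "same_contiguity_class K L \<phi> \<psi>"
  shows "SimpD \<iota> K L \<phi> \<psi> = 0"
proof -
  obtain c where c: "c_contiguous c K L \<phi> \<psi>"
    using assms(6) unfolding same_contiguity_class_def by blast
  \<comment> \<open>The threshold \<open>c\<close> does not depend on \<open>b\<close>:
    precomposition preserves the length of the chain.\<close>
  have "SimpD_bc \<iota> K L b d \<phi> \<psi> = 0" if "d \<ge> c" for b d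
    using c_contiguous_comp[OF simplicial_map_iota_to_base[OF assms(3)] c_contiguous_mono[OF c that]]
    by (rule SimpD_bc_eq_0[OF assms(1)])
  then have "SimpD_b \<iota> K L b \<phi> \<psi> = 0" for b
    unfolding SimpD_b_def by (intro stable_value_eqI eventually_sequentiallyI)
  then show ?thesis
    unfolding SimpD_def by (intro stable_value_eqI) simp
qed

end
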